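(* Fix an integer $m\geq 2$. Let $\Gamma$ be a distance-regular graph with diameter $D\ge 2$ whose smallest eigenvalue $\theta_D$ satisfies $-m\leq \theta_D<1-m$. If the intersection numbers $a_1$ and $c_2$ satisfy $a_1>m^2c_2$, then $\Gamma$ is geometric and $\theta_D=-m$.
   Context: A finite connected graph $\Gamma$ with diameter $D$ is distance-regular if there are integers $b_i,c_i$ ($0\le i\le D$) such that for any vertices $x,y$ with $d(x,y)=i$, exactly $c_i$ neighbours of $y$ are at distance $i-1$ from $x$ and exactly $b_i$ neighbours of $y$ are at distance $i+1$ from $x$; its valency is $k=b_0$ and $a_i:=k-b_i-c_i$. The smallest eigenvalue $\theta_D$ is that of the adjacency matrix. A Delsarte clique is a clique with exactly $1+\frac{k}{-\theta_D}$ vertices. A non-complete distance-regular graph is geometric if there is a set $\mathcal C$ of Delsarte cliques such that every edge lies in exactly one member of $\mathcal C$. *)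

theory Defs
  imports Complex_Main
begin

text \<open>A finite simple graph: vertex set V, symmetric irreflexive adjacency E on V.\<close>
definition simple_graph :: "'a set \<Rightarrow> ('a \<Rightarrow> 'a \<Rightarrow> bool) \<Rightarrow> bool" where
  "simple_graph V E \<longleftrightarrow> finite V \<and> V \<noteq> {} \<and>
     (\<forall>x y. E x y \<longrightarrow> x \<in> V \<and> y \<in> V) \<and>
     (\<forall>x y. E x y \<longrightarrow> E y x) \<and> (\<forall>x. \<not> E x x)"

definition edge_rel :: "'a set \<Rightarrow> ('a \<Rightarrow> 'a \<Rightarrow> bool) \<Rightarrow> ('a \<times> 'a) set" where
  "edge_rel V E = {(x, y). x \<in> V \<and> y \<in> V \<and> E x y}"

definition connected_graph :: "'a set \<Rightarrow> ('a \<Rightarrow> 'a \<Rightarrow> bool) \<Rightarrow> bool" where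
  "connected_graph V E \<longleftrightarrow> (\<forall>x\<in>V. \<forall>y\<in>V. (x, y) \<in> (edge_rel V E)\<^sup>*)"

text \<open>Path-length distance: least number of edges of a walk from x to y.\<close>
definition gdist :: "'a set \<Rightarrow> ('a \<Rightarrow> 'a \<Rightarrow> bool) \<Rightarrow> 'a \<Rightarrow> 'a \<Rightarrow> nat" where
  "gdist V E x y = (LEAST n. (x, y) \<in> (edge_rel V E) ^^ n)"

definition diameter :: "'a set \<Rightarrow> ('a \<Rightarrow> 'a \<Rightarrow> bool) \<Rightarrow> nat" where
  "diameter V E = Max {gdist V E x y | x y. x \<in> V \<and> y \<in> V}"

text \<open>Distance-regular with intersection numbers b i, c i: for x, y at distance i,
  c i neighbours of y are at distance i-1 from x and b i are at distance i+1.\<close>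
definition distance_regular ::
  "'a set \<Rightarrow> ('a \<Rightarrow> 'a \<Rightarrow> bool) \<Rightarrow> (nat \<Rightarrow> nat) \<Rightarrow> (nat \<Rightarrow> nat) \<Rightarrow> bool" where
  "distance_regular V E b c \<longleftrightarrow> simple_graph V E \<and> connected_graph V E \<and>
     (\<forall>x\<in>V. \<forall>y\<in>V.
        card {z \<in> V. E y z \<and> gdist V E x z + 1 = gdist V E x y} = c (gdist V E x y) \<and>
        card {z \<in> V. E y z \<and> gdist V E x z = gdist V E x y + 1} = b (gdist V E x y))"

text \<open>Intersection number a_i = k - b_i - c_i with k = b_0.\<close>
definition inter_a :: "(nat \<Rightarrow> nat) \<Rightarrow> (nat \<Rightarrow> nat) \<Rightarrow> nat \<Rightarrow> int" where
  "inter_a b c i = int (b 0) - int (b i) - int (c i)"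

text \<open>Eigenvalue of the adjacency matrix, viewed as operator on real functions on V.\<close>
definition adj_eigenvalue :: "'a set \<Rightarrow> ('a \<Rightarrow> 'a \<Rightarrow> bool) \<Rightarrow> real \<Rightarrow> bool" where
  "adj_eigenvalue V E \<theta> \<longleftrightarrow> (\<exists>f :: 'a \<Rightarrow> real. (\<exists>x\<in>V. f x \<noteq> 0) \<and>
     (\<forall>x\<in>V. (\<Sum>y\<in>{y \<in> V. E x y}. f y) = \<theta> * f x))"

definition smallest_eigenvalue :: "'a set \<Rightarrow> ('a \<Rightarrow> 'a \<Rightarrow> bool) \<Rightarrow> real \<Rightarrow> bool" where
  "smallest_eigenvalue V E \<theta> \<longleftrightarrow> adj_eigenvalue V E \<theta> \<and>
     (\<forall>\<theta>'. adj_eigenvalue V E \<theta>' \<longrightarrow> \<theta> \<le> \<theta>')"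

definition is_clique :: "'a set \<Rightarrow> ('a \<Rightarrow> 'a \<Rightarrow> bool) \<Rightarrow> 'a set \<Rightarrow> bool" where
  "is_clique V E C \<longleftrightarrow> C \<subseteq> V \<and> (\<forall>x\<in>C. \<forall>y\<in>C. x \<noteq> y \<longrightarrow> E x y)"

text \<open>Delsarte clique: clique with exactly 1 + k/(-theta_D) vertices.\<close>
definition delsarte_clique ::
  "'a set \<Rightarrow> ('a \<Rightarrow> 'a \<Rightarrow> bool) \<Rightarrow> nat \<Rightarrow> real \<Rightarrow> 'a set \<Rightarrow> bool" where
  "delsarte_clique V E k \<theta> C \<longleftrightarrow> is_clique V E C \<and> real (card C) = 1 + real k / (- \<theta>)"

definition complete_graph :: "'a set \<Rightarrow> ('a \<Rightarrow> 'a \<Rightarrow> bool) \<Rightarrow> bool" where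
  "complete_graph V E \<longleftrightarrow> (\<forall>x\<in>V. \<forall>y\<in>V. x \<noteq> y \<longrightarrow> E x y)"

text \<open>Geometric: non-complete and some family of Delsarte cliques partitions the edges.\<close>
definition geometric ::
  "'a set \<Rightarrow> ('a \<Rightarrow> 'a \<Rightarrow> bool) \<Rightarrow> nat \<Rightarrow> real \<Rightarrow> bool" where
  "geometric V E k \<theta> \<longleftrightarrow> \<not> complete_graph V E \<and>
     (\<exists>\<C>. (\<forall>C\<in>\<C>. delsarte_clique V E k \<theta> C) \<and>
          (\<forall>x y. E x y \<longrightarrow> (\<exists>!C. C \<in> \<C> \<and> x \<in> C \<and> y \<in> C)))"

end

theory Submission
  imports Defs "HOL-Analysis.Function_Topology"
begin

text \<open>Write \<open>\<lambda> = a_1\<close> and \<open>\<mu> = c_2\<close>. Since \<open>A + m I\<close> is positive semidefinite, a test vector on a vertex and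
  its neighbours gives \<open>k \<le> m (\<lambda> + m)\<close>, and inclusion-exclusion then excludes claws with \<open>m + 1\<close> leaves.
  As in Metsch's work, a maximum independent set of the local graph at \<open>x\<close> splits the neighbours of \<open>x\<close>
  into at most \<open>m\<close> large cliques, because a vertex with more than \<open>\<mu> - 1\<close> neighbours in such a clique is
  adjacent to all of it. So every edge lies in a unique \<open>line\<close>, a large maximal clique. Counting shows
  that the number of lines at a vertex is a constant \<open>r \<le> m\<close>, and the point-line incidence matrix \<open>N\<close>
  satisfies \<open>N N\<^sup>T = A + r I\<close>; hence \<open>\<theta> < 1 - m\<close> forces \<open>r = m\<close>. There are fewer lines than vertices, so
  \<open>A + m I\<close> is singular and \<open>\<theta> = -m\<close>. Finally a radial eigenfunction for \<open>-m\<close> around a point of a line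
  has sum zero on that line, and this says that the line has \<open>1 + k / m\<close> points.\<close>

section \<open>Linear algebra\<close>

text \<open>Gaussian elimination, one equation at a time. It later yields a nonzero vector whose sum
  over every line vanishes.\<close>

lemma underdetermined_system:
  fixes g :: "'l \<Rightarrow> 'a \<Rightarrow> real"
  assumes "finite L" "finite V" "card L < card V"
  shows "\<exists>f. (\<exists>v\<in>V. f v \<noteq> 0) \<and> (\<forall>l\<in>L. (\<Sum>v\<in>V. g l v * f v) = 0)"
  using assms
proof (induction L arbitrary: V g rule: finite_induct)
  case empty
  then obtain v where "v \<in> V" by (auto simp: card_gt_0_iff)
  then show ?case by (intro exI[of _ "\<lambda>_. 1"]) auto
next
  case (insert l0 L)
  show ?case
  proof (cases "\<forall>v\<in>V. g l0 v = 0")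
    case True
    have "card L < card V" using insert by simp
    from insert.IH[OF insert.prems(1) this, of g] obtain f
      where "\<exists>v\<in>V. f v \<noteq> 0" "\<forall>l\<in>L. (\<Sum>v\<in>V. g l v * f v) = 0" by auto
    then show ?thesis using True by (intro exI[of _ f]) auto
  next
    case False
    then obtain p where p: "p \<in> V" "g l0 p \<noteq> 0" by auto
    define W where "W = V - {p}"
    have W: "finite W" "card L < card W" "V = insert p W" "p \<notin> W"
      using insert p by (auto simp: W_def)
    from insert.IH[OF W(1,2), of "\<lambda>l v. g l v - g l p * g l0 v / g l0 p"] obtain f
      where f: "\<exists>v\<in>W. f v \<noteq> 0"
        and f0: "\<forall>l\<in>L. (\<Sum>v\<in>W. (g l v - g l p * g l0 v / g l0 p) * f v) = 0" by auto
    \<comment> \<open>The pivot equation \<open>l0\<close> forces the value \<open>- s\<close> at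
      \<open>p\<close>; in the other equations \<open>p\<close> has already been eliminated.\<close>
    define s where "s = (\<Sum>v\<in>W. g l0 v * f v) / g l0 p"
    have s: "(\<Sum>v\<in>W. (g l v - g l p * g l0 v / g l0 p) * f v) = (\<Sum>v\<in>W. g l v * f v) - g l p * s" for l
      unfolding s_def by (simp add: sum_subtractf sum_distrib_left sum_divide_distrib algebra_simps)
    have upd: "(\<Sum>v\<in>V. g l v * (f(p := - s)) v) = (\<Sum>v\<in>W. g l v * f v) - g l p * s" for l
    proof -
      have "(\<Sum>v\<in>W. g l v * (f(p := - s)) v) = (\<Sum>v\<in>W. g l v * f v)"
        using W(4) by (intro sum.cong) auto
      then show ?thesis using W by simp
    qed
    have "(\<Sum>v\<in>W. g l0 v * f v) - g l0 p * s = 0" using p by (simp add: s_def)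
    then have "\<forall>l\<in>insert l0 L. (\<Sum>v\<in>V. g l v * (f(p := - s)) v) = 0"
      unfolding upd using f0 s by auto
    moreover have "\<exists>v\<in>V. (f(p := - s)) v \<noteq> 0" using f W by auto
    ultimately show ?thesis by blast
  qed
qed

section \<open>Rayleigh's principle for the smallest eigenvalue\<close>

text \<open>The quadratic polynomial in \<open>e\<close> has a minimum at \<open>e = 0\<close>, so
  its derivative there vanishes.\<close>

lemma linear_coeff_zero:
  fixes P Q :: real
  assumes "\<And>e. 0 \<le> 2 * e * P + e\<^sup>2 * Q"
  shows "P = 0"
proof (rule ccontr)
  assume "P \<noteq> 0"
  \<comment> \<open>With \<open>R\<close> positive and larger than \<open>Q\<close>, the choice
    \<open>e = - P / R\<close> lets the linear term outweigh the quadratic one.\<close>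
  define R where "R = \<bar>Q\<bar> + 1"
  have R: "R > 0" "Q < R" unfolding R_def by auto
  have "0 \<le> 2 * (- P / R) * P + (- P / R)\<^sup>2 * Q" by (rule assms)
  also have "\<dots> = P\<^sup>2 / R * (Q / R - 2)"
    using R by (simp add: field_simps power2_eq_square)
  also have "\<dots> < 0"
    using R \<open>P \<noteq> 0\<close> by (intro mult_pos_neg) (auto simp: field_simps)
  finally show False by simp
qed

text \<open>The form attains a minimum \<open>t\<close> on the unit sphere. The first variation
  makes the minimiser an eigenvector, so \<open>t\<close> is an eigenvalue and
  \<open>\<theta> \<le> t\<close>; homogeneity extends the bound to all vectors.\<close>

lemma quadratic_form_ge_smallest_eigenvalue:
  fixes a :: "'a \<Rightarrow> 'a \<Rightarrow> real"
  assumes fin: "finite V" and sym: "\<And>x y. a x y = a y x"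
    and ev: "\<And>t g. \<exists>x\<in>V. g x \<noteq> 0 \<Longrightarrow> \<forall>x\<in>V. (\<Sum>y\<in>V. a x y * g y) = t * g x \<Longrightarrow> \<theta> \<le> t"
  shows "\<theta> * (\<Sum>x\<in>V. (f x)\<^sup>2) \<le> (\<Sum>x\<in>V. \<Sum>y\<in>V. a x y * f x * f y)"
proof (cases "\<exists>x\<in>V. f x \<noteq> 0")
  case False
  then show ?thesis by simp
next
  case True
  define N where "N = (\<lambda>h::'a \<Rightarrow> real. \<Sum>x\<in>V. (h x)\<^sup>2)"
  define q where "q = (\<lambda>h. \<Sum>x\<in>V. \<Sum>y\<in>V. a x y * h x * h y)"
  define nrm where "nrm = (\<lambda>h x. if x \<in> V then h x / sqrt (N h) else 0)"
  \<comment> \<open>Functions live on the whole type; pinning them to 0 off \<open>V\<close> makes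
    this cube compact in the product topology.\<close>
  define B where "B = PiE UNIV (\<lambda>x. if x \<in> V then {-1..1::real} else {0})"
  define K where "K = B \<inter> {h. N h = 1}"
  have "compactin (product_topology (\<lambda>_. euclidean) UNIV) B"
    unfolding B_def by (subst compactin_PiE) auto
  then have "compact B" by (simp add: euclidean_product_topology)
  moreover have contN: "continuous_on UNIV N" unfolding N_def
    by (intro continuous_intros) simp
  then have "closed {h. N h = 1}"
    by (intro closed_Collect_eq) (auto intro: continuous_intros)
  ultimately have "compact K" unfolding K_def by (rule compact_Int_closed)
  have N_pos: "N h > 0" if "\<exists>x\<in>V. h x \<noteq> 0" for h
    using that fin unfolding N_def by (auto intro!: sum_pos2)
  have nrm_N: "N (nrm h) = 1" if "N h > 0" for h
  proof -
    have "N (nrm h) = (\<Sum>x\<in>V. (nrm h x)\<^sup>2)" by (simp add: N_def)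
    also have "\<dots> = (\<Sum>x\<in>V. (h x)\<^sup>2 / N h)"
      using that by (intro sum.cong) (auto simp: power_divide nrm_def)
    finally show ?thesis using that by (simp add: sum_divide_distrib[symmetric] N_def)
  qed
  have nrm_K: "nrm h \<in> K" if "N h > 0" for h
  proof -
    have nrm_out: "nrm h x = 0" if "x \<notin> V" for x using that by (simp add: nrm_def)
    have le1: "\<bar>nrm h x\<bar> \<le> 1" if "x \<in> V" for x
    proof -
      have "(nrm h x)\<^sup>2 \<le> N (nrm h)" unfolding N_def
        using that fin by (intro member_le_sum) auto
      then show ?thesis using nrm_N[OF \<open>N h > 0\<close>] by (simp add: abs_square_le_1)
    qed
    have "nrm h x \<in> (if x \<in> V then {-1..1} else {0})" for x
      using le1[of x] by (cases "x \<in> V") (auto simp: abs_le_iff minus_le_iff nrm_out simp del: abs_divide)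
    then show ?thesis using nrm_N[OF that] by (simp add: K_def B_def PiE_iff)
  qed
  have nrm_q: "q (nrm h) = q h / N h" if "N h > 0" for h
  proof -
    have "q (nrm h) = (\<Sum>x\<in>V. \<Sum>y\<in>V. a x y * h x * h y / N h)" unfolding q_def nrm_def
      using that by (intro sum.cong) (auto simp: field_simps)
    then show ?thesis by (simp add: sum_divide_distrib[symmetric] q_def)
  qed
  have "K \<noteq> {}" using nrm_K[OF N_pos[OF True]] by auto
  moreover have "continuous_on K q" unfolding q_def
    by (intro continuous_intros continuous_on_subset[OF continuous_on_product_coordinates]) auto
  ultimately obtain g where g: "g \<in> K" "\<And>h. h \<in> K \<Longrightarrow> q g \<le> q h"
    using continuous_attains_inf[OF \<open>compact K\<close>] by blast
  define t where "t = q g"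
  have Ng: "N g = 1" using g by (simp add: K_def)
  have min: "t * N h \<le> q h" for h
  proof (cases "\<exists>x\<in>V. h x \<noteq> 0")
    case True
    then have "N h > 0" by (rule N_pos)
    then have "t \<le> q h / N h" using g(2)[OF nrm_K] nrm_q t_def by metis
    then show ?thesis using \<open>N h > 0\<close> by (simp add: field_simps)
  next
    case False
    then show ?thesis by (simp add: N_def q_def)
  qed
  \<comment> \<open>The residual of the eigenvalue equation for the minimiser \<open>g\<close>.
    Varying \<open>g\<close> in the direction \<open>h\<close> gives a first-order coefficient equal
    to twice the squared norm of \<open>h\<close>, which must therefore vanish.\<close>
  define h where "h = (\<lambda>x. (\<Sum>y\<in>V. a x y * g y) - t * g x)"
  have hh: "(\<Sum>x\<in>V. h x * h x) = (\<Sum>x\<in>V. \<Sum>y\<in>V. a x y * h x * g y) - t * (\<Sum>x\<in>V. h x * g x)"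
    by (subst (2) h_def) (simp add: algebra_simps sum_subtractf sum_distrib_left)
  have sw: "(\<Sum>x\<in>V. \<Sum>y\<in>V. a x y * g x * h y) = (\<Sum>x\<in>V. \<Sum>y\<in>V. a x y * h x * g y)"
    by (subst sum.swap) (auto intro!: sum.cong simp: sym)
  have "(\<Sum>x\<in>V. h x * h x) = 0"
  proof (rule linear_coeff_zero[where Q = "q h - t * N h"])
    fix e :: real
    have "q (\<lambda>x. g x + e * h x) = q g + e * (\<Sum>x\<in>V. \<Sum>y\<in>V. a x y * h x * g y)
        + e * (\<Sum>x\<in>V. \<Sum>y\<in>V. a x y * g x * h y) + e\<^sup>2 * q h"
      unfolding q_def sum_distrib_left
      by (simp add: sum.distrib[symmetric] algebra_simps power2_eq_square)
    moreover have "N (\<lambda>x. g x + e * h x) = N g + 2 * e * (\<Sum>x\<in>V. h x * g x) + e\<^sup>2 * N h"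
      unfolding N_def sum_distrib_left
      by (simp add: sum.distrib[symmetric] algebra_simps power2_eq_square)
    ultimately show "0 \<le> 2 * e * (\<Sum>x\<in>V. h x * h x) + e\<^sup>2 * (q h - t * N h)"
      using min[of "\<lambda>x. g x + e * h x"] Ng unfolding hh sw t_def[symmetric]
      by (simp add: algebra_simps)
  qed
  then have "\<forall>x\<in>V. h x = 0" using fin by (simp add: sum_nonneg_eq_0_iff)
  then have "\<forall>x\<in>V. (\<Sum>y\<in>V. a x y * g y) = t * g x" by (simp add: h_def)
  moreover have "\<exists>x\<in>V. g x \<noteq> 0"
  proof (rule ccontr)
    assume "\<not> (\<exists>x\<in>V. g x \<noteq> 0)"
    then have "N g = 0" by (simp add: N_def)
    with Ng show False by simp
  qed
  ultimately have "\<theta> \<le> t" by (rule ev[rotated])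
  then have "\<theta> * N f \<le> t * N f" using N_pos[OF True] by simp
  then show ?thesis using min[of f] by (simp add: N_def q_def)
qed

section \<open>Cliques in claw-free graphs with few common neighbours\<close>

locale simple_graph_on =
  fixes V :: "'a set" and E :: "'a \<Rightarrow> 'a \<Rightarrow> bool"
  assumes graph: "simple_graph V E"
begin

lemma finite_V: "finite V" and irrefl [simp]: "\<not> E x x" and sym: "E x y \<Longrightarrow> E y x"
  and in_V: "E x y \<Longrightarrow> x \<in> V \<and> y \<in> V"
  using graph unfolding simple_graph_def by auto

lemma finite_nbrs [simp]: "finite {y. E x y}" "finite {y. E x y \<and> P y}"
  by (rule finite_subset[OF _ finite_V]; use in_V in blast)+

lemma adj_commute: "E x y \<longleftrightarrow> E y x"
  using sym by blast

lemma sum_nbrs: "(\<Sum>y\<in>{y \<in> V. E x y}. f y) = (\<Sum>y | E x y. f y)"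
  by (rule sum.cong) (use in_V in auto)

lemma sum_nbrs_if: "(\<Sum>y | E x y. f y) = (\<Sum>y\<in>V. if E x y then f y else 0)"
  unfolding sum_nbrs[symmetric] by (rule sum.inter_filter[OF finite_V])

end

text \<open>The local conditions that produce lines. In the application \<open>l\<close> is a_1 and
  \<open>n\<close> is c_2 - 1: of the c_2 common neighbours of \<open>y\<close> and
  \<open>z\<close>, the vertex \<open>x\<close> is not counted.\<close>

locale line_graph_conditions = simple_graph_on V E
  for V :: "'a set" and E :: "'a \<Rightarrow> 'a \<Rightarrow> bool" +
  fixes l n m :: nat
  assumes common_adj: "E x y \<Longrightarrow> card {z. E x z \<and> E y z} = l"
    and common_nonadj: "\<lbrakk>E x y; E x z; y \<noteq> z; \<not> E y z\<rbrakk> \<Longrightarrow> card {w. E x w \<and> E y w \<and> E z w} \<le> n"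
    and claw_bound: "\<lbrakk>S \<subseteq> {y. E x y}; \<And>y z. \<lbrakk>y \<in> S; z \<in> S\<rbrakk> \<Longrightarrow> \<not> E y z\<rbrakk> \<Longrightarrow> card S \<le> m"
    and l_large: "m\<^sup>2 * (n + 1) < l"
begin

text \<open>By irreflexivity, the second conjunct says that the clique is maximal.\<close>

definition line :: "'a set \<Rightarrow> bool" where
  "line C \<longleftrightarrow> is_clique V E C \<and> (\<forall>v. \<exists>w\<in>C. \<not> E v w) \<and> l + 2 \<le> card C + (m - 1) * n"

lemma clique_adj: "\<lbrakk>is_clique V E C; x \<in> C; y \<in> C; x \<noteq> y\<rbrakk> \<Longrightarrow> E x y"
  unfolding is_clique_def by auto

lemma line_finite: "line C \<Longrightarrow> finite C"
  unfolding line_def is_clique_def using finite_V finite_subset by auto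

lemma points_of_line: "line C \<Longrightarrow> {x \<in> V. x \<in> C} = C"
  unfolding line_def is_clique_def by auto

lemma line_adj: "\<lbrakk>line C; x \<in> C; y \<in> C; x \<noteq> y\<rbrakk> \<Longrightarrow> E x y"
  unfolding line_def using clique_adj by blast

text \<open>The right side exceeds the left by \<open>(m - 1)\<^sup>2 * n\<close>.\<close>

lemma two_m_le: "m \<ge> 1 \<Longrightarrow> 2 * (m - 1) * n + n \<le> m\<^sup>2 * n"
proof -
  assume "m \<ge> 1"
  then obtain j where "m = Suc j" by (cases m) auto
  then show ?thesis by (simp add: power2_eq_square algebra_simps)
qed

lemma m_minus_le: "(m - 1) * n \<le> m\<^sup>2 * n"
proof -
  have "m - 1 \<le> m\<^sup>2" by (cases m) (auto simp: power2_eq_square)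
  then show ?thesis by simp
qed

lemma line_card_gt: assumes "line C" shows "m\<^sup>2 + 2 < card C"
  using assms m_minus_le l_large unfolding line_def by (simp add: algebra_simps)

text \<open>Two distinct lines meet in few points, yet their union is confined to \<open>x\<close>,
  \<open>y\<close> and the \<open>l\<close> common neighbours of \<open>x\<close> and
  \<open>y\<close>. Both lines are too large for that.\<close>

lemma two_lines_through_edge:
  assumes C: "line C" "line C'" and xy: "E x y" "x \<in> C" "y \<in> C" "x \<in> C'" "y \<in> C'" and m: "m \<ge> 1"
  shows "C = C'"
proof (rule ccontr)
  assume "C \<noteq> C'"
  \<comment> \<open>If all such pairs were adjacent, maximality would put each line inside the
    other.\<close>
  have "\<exists>z\<in>C. \<exists>w\<in>C'. z \<noteq> w \<and> \<not> E z w"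
  proof (rule ccontr)
    assume "\<not> ?thesis"
    then have all: "\<And>z w. \<lbrakk>z \<in> C; w \<in> C'; z \<noteq> w\<rbrakk> \<Longrightarrow> E z w" by blast
    have "z \<in> C'" if "z \<in> C" for z using C(2) all[OF that] that unfolding line_def by metis
    moreover have "z \<in> C" if "z \<in> C'" for z using C(1) all[OF _ that] that sym unfolding line_def by metis
    ultimately show False using \<open>C \<noteq> C'\<close> by blast
  qed
  then obtain z w where zw: "z \<in> C" "w \<in> C'" "z \<noteq> w" "\<not> E z w" by blast
  then have Exzw: "E x z" "E x w" using C xy line_adj by metis+
  have "z \<notin> C'" "w \<notin> C" using C zw line_adj by metis+
  then have "C \<inter> C' - {x} \<subseteq> {v. E x v \<and> E z v \<and> E w v}"
    using line_adj[OF C(1) xy(2)] line_adj[OF C(1) zw(1)] line_adj[OF C(2) zw(2)] by fastforce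
  then have "card (C \<inter> C' - {x}) \<le> n"
    by (rule order_trans[OF card_mono[OF finite_nbrs(2)] common_nonadj[OF Exzw zw(3,4)]])
  moreover have "card (C \<inter> C') = card (C \<inter> C' - {x}) + 1"
    using xy line_finite[OF C(1)] card_Suc_Diff1[of "C \<inter> C'" x] by simp
  ultimately have 1: "card (C \<inter> C') \<le> n + 1" by simp
  have "C \<union> C' - {x, y} \<subseteq> {v. E x v \<and> E y v}" using C xy line_adj by auto
  then have 2: "card (C \<union> C' - {x, y}) \<le> l"
    using card_mono[OF finite_nbrs(2)] common_adj[OF xy(1)] by metis
  have "card (C \<union> C') = card (C \<union> C' - {x, y}) + card {x, y}"
    using xy line_finite[OF C(1)] line_finite[OF C(2)] by (subst card_Diff_subset) (auto simp: card_mono)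
  moreover have "card {x, y} = 2" using xy irrefl by (auto simp: card_insert_if)
  ultimately have "card (C \<union> C') \<le> l + 2" using 2 by simp
  moreover have "card C + card C' = card (C \<union> C') + card (C \<inter> C')"
    using C line_finite card_Un_Int by blast
  moreover have "l + 2 \<le> card C + (m - 1) * n" "l + 2 \<le> card C' + (m - 1) * n"
    using C unfolding line_def by auto
  \<comment> \<open>Comparing sizes gives \<open>l + 1 \<le> 2 * (m - 1) * n + n\<close>, hence
    \<open>l < m\<^sup>2 * n\<close>.\<close>
  ultimately show False using 1 l_large two_m_le[OF m] by (simp add: algebra_simps)
qed

section \<open>Lines from a maximum independent set of the local graph\<close>

text \<open>Each member \<open>y\<close> of a maximum independent set \<open>S\<close> of the local
  graph at \<open>x\<close> has a large clique \<open>L y\<close> of private neighbours. Its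
  extension \<open>T y\<close> together with \<open>x\<close> is a line, and the sets
  \<open>T y\<close> cover the local graph.\<close>

lemma lines_cover_nbrs:
  assumes "x \<in> V"
  shows "\<exists>F. finite F \<and> card F \<le> m \<and> (\<forall>C\<in>F. line C \<and> x \<in> C) \<and> (\<forall>z. E x z \<longrightarrow> (\<exists>C\<in>F. z \<in> C))"
proof -
  define ind where "ind = (\<lambda>S. S \<subseteq> {y. E x y} \<and> (\<forall>y\<in>S. \<forall>z\<in>S. \<not> E y z))"
  have "\<exists>S. ind S \<and> (\<forall>S'. ind S' \<longrightarrow> card S' \<le> card S)"
  proof (rule ex_has_greatest_nat[where b = "Suc m"])
    show "ind {}" by (simp add: ind_def)
    show "\<forall>S. ind S \<longrightarrow> card S < Suc m" unfolding ind_def less_Suc_eq_le using claw_bound by blast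
  qed
  then obtain S where S: "ind S" and max: "\<And>S'. ind S' \<Longrightarrow> card S' \<le> card S" by blast
  have S_nbr: "\<And>y. y \<in> S \<Longrightarrow> E x y" and S_ind: "\<And>y z. \<lbrakk>y \<in> S; z \<in> S\<rbrakk> \<Longrightarrow> \<not> E y z"
    using S unfolding ind_def by auto
  have S_fin: "finite S" using S finite_subset[OF _ finite_nbrs(1)] unfolding ind_def by blast
  have S_card: "card S \<le> m" using S claw_bound unfolding ind_def by blast
  define common where "common = (\<lambda>y z. {w. E x w \<and> E y w \<and> E z w})"
  have common_le: "card (common y z) \<le> n" if "E x y" "E x z" "y \<noteq> z" "\<not> E y z" for y z
    unfolding common_def using that by (rule common_nonadj)
  have common_fin [simp]: "finite (common y z)" for y z unfolding common_def by simp
  \<comment> \<open>\<open>L y\<close> consists of \<open>y\<close> and the vertices whose only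
    neighbour in \<open>S\<close> is \<open>y\<close>; \<open>T y\<close> collects every vertex of
    the local graph that can be added to \<open>L y\<close>.\<close>
  define L where "L = (\<lambda>y. {z. E x z \<and> (z = y \<or> E y z \<and> (\<forall>y'\<in>S - {y}. \<not> E y' z))})"
  define T where "T = (\<lambda>y. {z. E x z \<and> (\<forall>w\<in>L y. w \<noteq> z \<longrightarrow> E z w)})"
  have L_fin [simp]: "finite (L y)" for y unfolding L_def by simp
  have L_nbr: "w \<in> L y \<Longrightarrow> E x w" for w y unfolding L_def by simp
  have S_max: "\<exists>y\<in>S. E y z" if "E x z" "z \<notin> S" for z
  proof (rule ccontr)
    assume "\<not> ?thesis"
    then have "\<not> E y z" "\<not> E z y" if "y \<in> S" for y using that sym[of z y] by auto
    then have "ind (insert z S)" unfolding ind_def using S_nbr S_ind that by auto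
    from max[OF this] show False using S_fin that by simp
  qed
  have L_clique: "E z w" if "y \<in> S" "z \<in> L y" "w \<in> L y" "z \<noteq> w" for y z w
  proof (rule ccontr)
    assume zw: "\<not> E z w"
    have wz: "\<not> E w z" using zw sym by blast
    have "z \<noteq> y" "w \<noteq> y" using that zw wz unfolding L_def by auto
    then have ad: "E y z" "E y w" "\<And>y'. y' \<in> S - {y} \<Longrightarrow> \<not> E y' z \<and> \<not> E y' w"
      using that unfolding L_def by auto
    have ad': "\<And>y'. y' \<in> S - {y} \<Longrightarrow> \<not> E z y' \<and> \<not> E w y'"
      using ad(3) sym by metis
    have "z \<notin> S" "w \<notin> S" using ad that S_ind by auto
    have "E x z" "E x w" using that L_nbr by auto
    \<comment> \<open>Exchanging \<open>y\<close> for two nonadjacent private neighbours would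
      enlarge \<open>S\<close>.\<close>
    then have "ind (insert z (insert w (S - {y})))"
      unfolding ind_def using S_nbr S_ind zw wz ad(3) ad' by auto
    from max[OF this] have "card (insert z (insert w (S - {y}))) \<le> card S" .
    then show False using S_fin \<open>z \<notin> S\<close> \<open>w \<notin> S\<close> \<open>z \<noteq> w\<close> card_Suc_Diff1[OF S_fin \<open>y \<in> S\<close>] by simp
  qed
  have common_S: "card (common y y') \<le> n" if "y \<in> S" "y' \<in> S - {y}" for y y'
    using that S_nbr S_ind by (intro common_le) auto
  have card_common_S: "card (\<Union>y'\<in>S - {y}. common y y') \<le> (card S - 1) * n" if "y \<in> S" for y
  proof -
    have "card (\<Union>y'\<in>S - {y}. common y y') \<le> (\<Sum>y'\<in>S - {y}. card (common y y'))"
      using S_fin by (intro card_UN_le) auto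
    also have "\<dots> \<le> (\<Sum>y'\<in>S - {y}. n)" using common_S[OF that] by (rule sum_mono)
    finally show ?thesis using that S_fin by simp
  qed
  have L_card: "l + 1 \<le> card (L y) + (m - 1) * n" if y: "y \<in> S" for y
  proof -
    \<comment> \<open>A common neighbour of \<open>x\<close> and \<open>y\<close> that is not
      private to \<open>y\<close> is shared with one of the at most \<open>m - 1\<close> other
      members of \<open>S\<close>, and each of them shares at most \<open>n\<close>.\<close>
    have "{z. E x z \<and> E y z} \<subseteq> (L y - {y}) \<union> (\<Union>y'\<in>S - {y}. common y y')"
      unfolding L_def common_def by auto
    then have "l \<le> card ((L y - {y}) \<union> (\<Union>y'\<in>S - {y}. common y y'))"
      using common_adj[OF S_nbr[OF y]] S_fin by (metis card_mono common_fin L_fin finite_Diff finite_UN_I finite_UnI)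
    also have "\<dots> \<le> card (L y - {y}) + card (\<Union>y'\<in>S - {y}. common y y')" by (rule card_Un_le)
    also have "\<dots> \<le> card (L y - {y}) + (card S - 1) * n" using card_common_S[OF y] by simp
    also have "\<dots> \<le> card (L y - {y}) + (m - 1) * n" using S_card by (intro add_mono mult_right_mono diff_le_mono) auto
    finally have "l \<le> card (L y - {y}) + (m - 1) * n" .
    moreover have "y \<in> L y" using S_nbr[OF y] unfolding L_def by simp
    ultimately show ?thesis using card_Suc_Diff1[OF L_fin \<open>y \<in> L y\<close>] by simp
  qed
  have m_pos: "m \<ge> 1" if "y \<in> S" for y
    using S_card that S_fin by (metis One_nat_def Suc_leI card_gt_0_iff empty_iff le_trans)
  have T_cover: "\<exists>y\<in>S. z \<in> T y" if z: "E x z" for z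
  proof (rule ccontr)
    assume "\<not> ?thesis"
    then have notT: "\<And>y. y \<in> S \<Longrightarrow> \<exists>w\<in>L y. w \<noteq> z \<and> \<not> E z w" using z unfolding T_def by auto
    \<comment> \<open>A vertex \<open>z\<close> outside \<open>T y\<close> misses some
      \<open>w\<close> in the clique \<open>L y\<close>, so its neighbours in \<open>L y\<close> are
      common neighbours of \<open>z\<close> and \<open>w\<close>.\<close>
    have 1: "card {v \<in> L y. E z v} \<le> n" if y: "y \<in> S" for y
    proof -
      obtain w where w: "w \<in> L y" "w \<noteq> z" "\<not> E z w" using notT[OF y] by blast
      have "{v \<in> L y. E z v} \<subseteq> common z w"
        unfolding common_def using L_clique[OF y w(1)] L_nbr w by auto
      from order_trans[OF card_mono[OF common_fin this] common_le[OF z L_nbr[OF w(1)]]]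
      show ?thesis using w by blast
    qed
    \<comment> \<open>By maximality of \<open>S\<close>, each such \<open>v\<close> lies in some
      \<open>L y\<close> or is adjacent to two members of \<open>S\<close>. Counting these gives at
      most \<open>m\<^sup>2 * n\<close> common neighbours of \<open>x\<close> and \<open>z\<close>,
      fewer than \<open>l\<close>.\<close>
    have "v \<in> (\<Union>y\<in>S. {v \<in> L y. E z v} \<union> (\<Union>y'\<in>S - {y}. common y y'))" if v: "E x v" "E z v" for v
    proof (cases "v \<in> S")
      case True
      then show ?thesis using v unfolding L_def by blast
    next
      case False
      then obtain y where y: "y \<in> S" "E y v" using S_max v by blast
      then show ?thesis using v unfolding L_def common_def by blast
    qed
    then have "{v. E x v \<and> E z v} \<subseteq> (\<Union>y\<in>S. {v \<in> L y. E z v} \<union> (\<Union>y'\<in>S - {y}. common y y'))"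
      by blast
    then have "l \<le> card (\<Union>y\<in>S. {v \<in> L y. E z v} \<union> (\<Union>y'\<in>S - {y}. common y y'))"
      using common_adj[OF z] S_fin by (subst common_adj[OF z, symmetric], intro card_mono) auto
    also have "\<dots> \<le> (\<Sum>y\<in>S. card ({v \<in> L y. E z v} \<union> (\<Union>y'\<in>S - {y}. common y y')))"
      by (rule card_UN_le[OF S_fin])
    also have "\<dots> \<le> (\<Sum>y\<in>S. n + (card S - 1) * n)"
      using 1 card_common_S by (intro sum_mono order_trans[OF card_Un_le] add_mono) auto
    also have "\<dots> \<le> card S * (card S * n)"
      by (cases "card S") auto
    also have "\<dots> \<le> m * (m * n)" using S_card by (intro mult_mono) auto
    finally show False using l_large by (simp add: power2_eq_square algebra_simps)
  qed
  have L_sub_T: "L y \<subseteq> T y" if "y \<in> S" for y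
    unfolding T_def using L_clique[OF that] L_nbr by auto
  have T_clique: "E z w" if y: "y \<in> S" and zw: "z \<in> T y" "w \<in> T y" "z \<noteq> w" for y z w
  proof (rule ccontr)
    assume n: "\<not> E z w"
    \<comment> \<open>Neither \<open>z\<close> nor \<open>w\<close> lies in \<open>L y\<close>,
      since the other one is adjacent to all the rest of \<open>L y\<close>. So the whole of
      \<open>L y\<close> would be common to a nonadjacent pair, but it has more than
      \<open>n\<close> elements.\<close>
    have "L y \<subseteq> common z w"
      unfolding common_def using zw n sym L_nbr unfolding T_def by auto
    moreover have "E x z" "E x w" using zw unfolding T_def by auto
    ultimately have "card (L y) \<le> n"
      using order_trans[OF card_mono[OF common_fin] common_le[of z w]] zw n by blast
    then show False using L_card[OF y] l_large two_m_le[OF m_pos[OF y]]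
      by (simp add: algebra_simps)
  qed
  have T_line: "line (insert x (T y))" if y: "y \<in> S" for y
    unfolding line_def
  proof (intro conjI allI)
    have "\<And>z. z \<in> T y \<Longrightarrow> E x z \<and> E z x \<and> z \<in> V"
      unfolding T_def using sym[of x] in_V[of x] by blast
    then show "is_clique V E (insert x (T y))"
      unfolding is_clique_def using T_clique[OF y] assms by auto
    show "\<exists>w\<in>insert x (T y). \<not> E v w" for v
    proof (rule ccontr)
      assume "\<not> ?thesis"
      then have v: "E v x" "\<And>w. w \<in> T y \<Longrightarrow> E v w" by auto
      \<comment> \<open>A vertex adjacent to \<open>x\<close> and to all of \<open>T y\<close>
        extends \<open>L y\<close>, so it belongs to \<open>T y\<close> and would be adjacent to
        itself.\<close>
      then have "v \<in> T y" using L_sub_T[OF y] sym[OF v(1)] unfolding T_def by auto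
      then show False using v(2) irrefl by blast
    qed
    have "card (L y) \<le> card (T y)"
      by (rule card_mono[OF _ L_sub_T[OF y]]) (simp add: T_def)
    moreover have "x \<notin> T y" "finite (T y)" by (auto simp: T_def)
    ultimately show "l + 2 \<le> card (insert x (T y)) + (m - 1) * n" using L_card[OF y] by simp
  qed
  show ?thesis
    using S_fin S_card T_line T_cover card_image_le[OF S_fin, of "\<lambda>y. insert x (T y)"]
    by (intro exI[of _ "(\<lambda>y. insert x (T y)) ` S"]) auto
qed

lemma edge_in_line: "E x y \<Longrightarrow> \<exists>C. line C \<and> x \<in> C \<and> y \<in> C"
  using lines_cover_nbrs[of x] in_V[of x y] by blast

section \<open>Counting lines through a vertex\<close>

abbreviation lines_at :: "'a \<Rightarrow> 'a set set" where
  "lines_at x \<equiv> {C. line C \<and> x \<in> C}"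

lemma finite_lines: "finite {C. line C}"
  using finite_subset[of "{C. line C}" "Pow V"] finite_V unfolding line_def is_clique_def by auto

lemma finite_lines_at [simp]: "finite (lines_at x)"
  using finite_lines by (rule rev_finite_subset) auto

text \<open>A line through \<open>x\<close> contains a neighbour of \<open>x\<close>, and a covering
  line contains the same edge, so the two coincide.\<close>

lemma card_lines_at_le:
  assumes "x \<in> V" and m: "m \<ge> 1" shows "card (lines_at x) \<le> m"
proof -
  obtain F where F: "finite F" "card F \<le> m" "\<And>C. C \<in> F \<Longrightarrow> line C \<and> x \<in> C"
    "\<And>z. E x z \<Longrightarrow> \<exists>C\<in>F. z \<in> C"
    using lines_cover_nbrs[OF assms(1)] by metis
  have "lines_at x \<subseteq> F"
  proof
    fix C assume "C \<in> lines_at x"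
    then have C: "line C" "x \<in> C" by auto
    have "C \<noteq> {x}" using line_card_gt[OF C(1)] by auto
    then obtain z where z: "z \<in> C" "z \<noteq> x" using C by blast
    then have "E x z" using C line_adj by metis
    then obtain C' where "C' \<in> F" "z \<in> C'" using F by blast
    then show "C \<in> F" using two_lines_through_edge[OF C(1) _ \<open>E x z\<close>] F(3) C z m by metis
  qed
  then show ?thesis using F card_mono le_trans by metis
qed

text \<open>The lines through \<open>x\<close>, with \<open>x\<close> removed, partition the
  neighbours of \<open>x\<close>.\<close>

lemma sum_over_nbrs:
  fixes f :: "'a \<Rightarrow> 'b::comm_monoid_add"
  assumes m: "m \<ge> 1"
  shows "(\<Sum>y | E x y. f y) = (\<Sum>C\<in>lines_at x. \<Sum>y\<in>C - {x}. f y)"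
proof -
  have "{y. E x y} = (\<Union>C\<in>lines_at x. C - {x})"
    using edge_in_line line_adj by fastforce
  moreover have "(\<Sum>y\<in>(\<Union>C\<in>lines_at x. C - {x}). f y) = (\<Sum>C\<in>lines_at x. \<Sum>y\<in>C - {x}. f y)"
  proof (rule sum.UNION_disjoint)
    show "\<forall>C\<in>lines_at x. finite (C - {x})" using line_finite by auto
    have "C = C'" if "line C" "line C'" "x \<in> C" "x \<in> C'" "y \<in> C" "y \<in> C'" "y \<noteq> x" for C C' y
      using two_lines_through_edge[OF that(1,2) line_adj[of C x y]] that m by metis
    then show "\<forall>C\<in>lines_at x. \<forall>C'\<in>lines_at x. C \<noteq> C' \<longrightarrow> (C - {x}) \<inter> (C' - {x}) = {}"
      by blast
  qed simp
  ultimately show ?thesis by simp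
qed

text \<open>The row at \<open>x\<close> of the identity \<open>N N\<^sup>T = A + R\<close>, where
  the diagonal matrix \<open>R\<close> counts the lines at each vertex.\<close>

lemma sum_over_lines:
  fixes f :: "'a \<Rightarrow> real"
  assumes m: "m \<ge> 1"
  shows "(\<Sum>y | E x y. f y) = (\<Sum>C\<in>lines_at x. \<Sum>y\<in>C. f y) - real (card (lines_at x)) * f x"
proof -
  have "(\<Sum>y | E x y. f y) = (\<Sum>C\<in>lines_at x. (\<Sum>y\<in>C. f y) - f x)"
    unfolding sum_over_nbrs[OF m] using line_finite by (intro sum.cong) (auto simp: sum_diff1)
  then show ?thesis by (simp add: sum_subtractf)
qed

lemma line_card_le:
  assumes "line C" shows "card C \<le> l + 2"
proof -
  have "card C \<ge> 2" using line_card_gt[OF assms] by simp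
  then obtain x y where xy: "x \<in> C" "y \<in> C" "x \<noteq> y"
    by (metis card_2_iff obtain_subset_with_card_n insert_subset)
  have "C - {x, y} \<subseteq> {v. E x v \<and> E y v}" using assms xy line_adj by auto
  then have "card (C - {x, y}) \<le> l"
    using card_mono[OF finite_nbrs(2)] common_adj[OF line_adj[OF assms xy]] by metis
  then show ?thesis using xy line_finite[OF assms] by (simp add: card_Diff_subset)
qed

text \<open>Line sizes vary by at most \<open>(m - 1) * n\<close>. One extra line at
  \<open>x\<close> would add about \<open>l\<close> to the degree, more than the total variation
  over at most \<open>m\<close> lines can compensate.\<close>

lemma card_lines_at_const:
  assumes deg: "card {z. E x z} = k" "card {z. E y z} = k" and m: "m \<ge> 1"
    and le: "card (lines_at x) \<le> m"
  shows "card (lines_at x) \<le> card (lines_at y)"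
proof (rule ccontr)
  assume "\<not> ?thesis"
  then have less: "card (lines_at y) + 1 \<le> card (lines_at x)" by simp
  have k: "k = (\<Sum>C\<in>lines_at v. card (C - {v}))" if "card {z. E v z} = k" for v
    using sum_over_nbrs[OF m, where x = v and f = "\<lambda>_. 1::nat"] that by simp
  let ?r = "card (lines_at x)"
  have "k \<le> (\<Sum>C\<in>lines_at y. l + 1)" unfolding k[OF deg(2)]
    using line_card_le by (intro sum_mono) fastforce
  then have "k \<le> card (lines_at y) * (l + 1)" by simp
  moreover have "(\<Sum>C\<in>lines_at x. l + 1) \<le> (\<Sum>C\<in>lines_at x. card (C - {x}) + (m - 1) * n)"
  proof (rule sum_mono)
    fix C assume "C \<in> lines_at x"
    then show "l + 1 \<le> card (C - {x}) + (m - 1) * n"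
      using card_Suc_Diff1[OF line_finite, of C x] unfolding line_def by auto
  qed
  then have "?r * (l + 1) \<le> k + ?r * ((m - 1) * n)"
    by (simp only: distrib_left sum.distrib k[OF deg(1), symmetric] sum_constant of_nat_id)
  ultimately have "?r * (l + 1) \<le> card (lines_at y) * (l + 1) + ?r * ((m - 1) * n)" by simp
  moreover have "(card (lines_at y) + 1) * (l + 1) \<le> ?r * (l + 1)" using less by (rule mult_right_mono) simp
  ultimately have "l + 1 \<le> ?r * ((m - 1) * n)" by simp
  also have "\<dots> \<le> m * (m * n)" using le by (intro mult_mono) auto
  finally show False using l_large by (simp add: power2_eq_square algebra_simps)
qed

section \<open>The point-line incidence matrix\<close>

text \<open>The quadratic form of \<open>N N\<^sup>T - R\<close>; the line sums of \<open>f\<close>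
  are the entries of \<open>N\<^sup>T f\<close>.\<close>

lemma adjacency_form_lines:
  fixes f :: "'a \<Rightarrow> real"
  assumes m: "m \<ge> 1"
  shows "(\<Sum>x\<in>V. f x * (\<Sum>y | E x y. f y)) =
    (\<Sum>C | line C. (\<Sum>y\<in>C. f y)\<^sup>2) - (\<Sum>x\<in>V. real (card (lines_at x)) * (f x)\<^sup>2)"
proof -
  have "(\<Sum>x\<in>V. f x * (\<Sum>y | E x y. f y)) =
      (\<Sum>x\<in>V. \<Sum>C | line C \<and> x \<in> C. f x * (\<Sum>y\<in>C. f y)) - (\<Sum>x\<in>V. real (card (lines_at x)) * (f x)\<^sup>2)"
    by (simp add: sum_over_lines[OF m] right_diff_distrib sum_distrib_left power2_eq_square
        sum_subtractf mult.left_commute)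
  moreover have "(\<Sum>x\<in>V. \<Sum>C | line C \<and> x \<in> C. f x * (\<Sum>y\<in>C. f y))
      = (\<Sum>C | line C. \<Sum>x | x \<in> V \<and> x \<in> C. f x * (\<Sum>y\<in>C. f y))"
    using sum.swap_restrict[OF finite_V finite_lines, of "\<lambda>x C. f x * (\<Sum>y\<in>C. f y)" "\<lambda>x C. x \<in> C"]
    by (simp only: mem_Collect_eq)
  moreover have "\<dots> = (\<Sum>C | line C. (\<Sum>y\<in>C. f y)\<^sup>2)"
    by (rule sum.cong) (simp_all add: points_of_line sum_distrib_right power2_eq_square)
  ultimately show ?thesis by simp
qed

text \<open>Incidences are counted twice: every vertex is on \<open>m\<close> lines, while every
  line has at least \<open>m + 1\<close> points.\<close>

lemma card_lines_less:
  assumes r: "\<And>x. x \<in> V \<Longrightarrow> card (lines_at x) = m"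
  shows "card {C. line C} < card V"
proof -
  have "V \<noteq> {}" using graph unfolding simple_graph_def by auto
  then have V: "card V > 0" using finite_V by (simp add: card_gt_0_iff)
  have "card {C. line C} * (m + 1) = (\<Sum>C | line C. m + 1)" by simp
  also have "\<dots> \<le> (\<Sum>C | line C. card C)"
  proof (rule sum_mono)
    fix C assume "C \<in> {C. line C}"
    then have "m\<^sup>2 + 2 < card C" using line_card_gt by simp
    moreover have "m \<le> m\<^sup>2" by (cases m) (auto simp: power2_eq_square)
    ultimately show "m + 1 \<le> card C" by simp
  qed
  also have "\<dots> = (\<Sum>C | line C. \<Sum>x | x \<in> V \<and> x \<in> C. 1)"
    by (rule sum.cong) (simp_all add: points_of_line)
  also have "\<dots> = (\<Sum>x\<in>V. \<Sum>C | line C \<and> x \<in> C. 1)"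
    using sum.swap_restrict[OF finite_V finite_lines, of "\<lambda>_ _. 1" "\<lambda>x C. x \<in> C", symmetric]
    by (simp only: mem_Collect_eq)
  also have "\<dots> = card V * m" using r by simp
  also have "\<dots> < card V * (m + 1)" using V by simp
  finally show ?thesis by (simp only: mult_less_cancel2)
qed

end

section \<open>Distance-regular graphs\<close>

text \<open>Inclusion-exclusion truncated after pairs, and doubled so that the number of pairs needs
  no division.\<close>

lemma bonferroni_uniform:
  fixes A :: "'b \<Rightarrow> 'c set"
  assumes "finite S" "\<And>y. y \<in> S \<Longrightarrow> finite (A y)" "\<And>y. y \<in> S \<Longrightarrow> s \<le> card (A y)"
    and "\<And>y z. \<lbrakk>y \<in> S; z \<in> S; y \<noteq> z\<rbrakk> \<Longrightarrow> card (A y \<inter> A z) \<le> n"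
  shows "2 * card S * s \<le> 2 * card (\<Union>y\<in>S. A y) + card S * (card S - 1) * n"
  using assms
proof (induction S rule: finite_induct)
  case (insert y S)
  let ?U = "\<Union>z\<in>S. A z"
  have "card (A y \<inter> ?U) \<le> (\<Sum>z\<in>S. card (A y \<inter> A z))"
    using card_UN_le[OF insert.hyps(1), of "\<lambda>z. A y \<inter> A z"] by simp
  also have "\<dots> \<le> (\<Sum>z\<in>S. n)" using insert by (intro sum_mono) auto
  finally have "card (A y \<inter> ?U) \<le> card S * n" by simp
  moreover have "card (A y) + card ?U = card (A y \<union> ?U) + card (A y \<inter> ?U)"
    using insert by (intro card_Un_Int) auto
  moreover have "2 * card S * s \<le> 2 * card ?U + card S * (card S - 1) * n"
    using insert by simp
  moreover have "s \<le> card (A y)" using insert by simp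
  moreover have "2 * (card S * n) + card S * (card S - 1) * n = (card S + 1) * card S * n"
    by (cases "card S") (auto simp: algebra_simps)
  moreover have "2 * (card S + 1) * s = 2 * card S * s + 2 * s" by simp
  ultimately have "2 * (card S + 1) * s \<le> 2 * card (A y \<union> ?U) + (card S + 1) * card S * n"
    by linarith
  then show ?case using insert.hyps by simp
qed simp

lemma (in simple_graph_on) adjacency_form_ge:
  assumes "smallest_eigenvalue V E \<theta>"
  shows "\<theta> * (\<Sum>x\<in>V. (f x)\<^sup>2) \<le> (\<Sum>x\<in>V. f x * (\<Sum>y | E x y. f y))"
proof -
  define a where "a = (\<lambda>x y. if E x y then 1 else 0 :: real)"
  have a: "(\<Sum>y\<in>V. a x y * h y) = (\<Sum>y | E x y. h y)" for x h
    unfolding a_def sum_nbrs_if by (rule sum.cong) auto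
  have "\<theta> * (\<Sum>x\<in>V. (f x)\<^sup>2) \<le> (\<Sum>x\<in>V. \<Sum>y\<in>V. a x y * f x * f y)"
  proof (rule quadratic_form_ge_smallest_eigenvalue[OF finite_V])
    show "a x y = a y x" for x y unfolding a_def by (simp add: adj_commute)
    show "\<theta> \<le> t" if "\<exists>x\<in>V. g x \<noteq> 0" "\<forall>x\<in>V. (\<Sum>y\<in>V. a x y * g y) = t * g x" for t g
      using assms that unfolding smallest_eigenvalue_def adj_eigenvalue_def sum_nbrs a by blast
  qed
  also have "\<dots> = (\<Sum>x\<in>V. f x * (\<Sum>y\<in>V. a x y * f y))"
    by (simp add: sum_distrib_left mult.assoc mult.left_commute)
  finally show ?thesis unfolding a .
qed

locale distance_regular_graph =
  fixes V :: "'a set" and E :: "'a \<Rightarrow> 'a \<Rightarrow> bool" and b c :: "nat \<Rightarrow> nat"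
  assumes dr: "distance_regular V E b c"
begin

sublocale simple_graph_on V E
  by unfold_locales (use dr in \<open>simp add: distance_regular_def\<close>)

abbreviation d :: "'a \<Rightarrow> 'a \<Rightarrow> nat" where "d \<equiv> gdist V E"

section \<open>Graph distance and intersection numbers\<close>

lemma edge_rel_iff: "(x, y) \<in> edge_rel V E \<longleftrightarrow> E x y"
  unfolding edge_rel_def using in_V by auto

lemma dist_path: "\<lbrakk>x \<in> V; y \<in> V\<rbrakk> \<Longrightarrow> (x, y) \<in> edge_rel V E ^^ d x y"
  unfolding gdist_def
  by (rule LeastI_ex) (use dr in \<open>auto simp: distance_regular_def connected_graph_def rtrancl_power\<close>)

lemma dist_le: "(x, y) \<in> edge_rel V E ^^ i \<Longrightarrow> d x y \<le> i"
  unfolding gdist_def by (rule Least_le)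

lemma dist_self [simp]: "d x x = 0"
  using dist_le[of x x 0] by simp

lemma dist_0_iff: "\<lbrakk>x \<in> V; y \<in> V\<rbrakk> \<Longrightarrow> d x y = 0 \<longleftrightarrow> x = y"
  using dist_path[of x y] by (cases "d x y") auto

lemma dist_1_iff: "\<lbrakk>x \<in> V; y \<in> V\<rbrakk> \<Longrightarrow> d x y = 1 \<longleftrightarrow> E x y"
proof
  assume "x \<in> V" "y \<in> V" "d x y = 1"
  then show "E x y" using dist_path[of x y] by (simp add: edge_rel_iff)
next
  assume xy: "x \<in> V" "y \<in> V" "E x y"
  then have "d x y \<le> 1" by (intro dist_le) (simp add: edge_rel_iff)
  moreover have "d x y \<noteq> 0" using xy dist_0_iff by auto
  ultimately show "d x y = 1" by simp
qed

lemma dist_adj: "E x y \<Longrightarrow> d x y = 1"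
  using dist_1_iff in_V by blast

lemma dist_edge_le:
  assumes "x \<in> V" "E y z" shows "d x z \<le> d x y + 1"
proof -
  have "(x, z) \<in> edge_rel V E ^^ Suc (d x y)"
    using dist_path[of x y] assms in_V[OF assms(2)] by (auto simp: edge_rel_iff)
  then show ?thesis using dist_le by fastforce
qed

lemma dist_edge_cases:
  assumes "x \<in> V" "E y z"
  shows "d x z + 1 = d x y \<or> d x z = d x y \<or> d x z = d x y + 1"
  using dist_edge_le[OF assms] dist_edge_le[OF assms(1) sym[OF assms(2)]] by linarith

lemma dist_pred:
  assumes "x \<in> V" "y \<in> V" "d x y = Suc i"
  obtains w where "w \<in> V" "E w y" "d x w = i"
proof -
  obtain w where w: "(x, w) \<in> edge_rel V E ^^ i" "E w y"
    using dist_path[OF assms(1,2)] unfolding assms(3) by (auto simp: edge_rel_iff)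
  have "d x w = i"
    using dist_le[OF w(1)] dist_edge_le[OF assms(1) w(2)] assms(3) by linarith
  then show thesis using that w in_V by blast
qed

lemma card_down: "\<lbrakk>x \<in> V; y \<in> V\<rbrakk> \<Longrightarrow> card {z. E y z \<and> d x z + 1 = d x y} = c (d x y)"
  and card_up: "\<lbrakk>x \<in> V; y \<in> V\<rbrakk> \<Longrightarrow> card {z. E y z \<and> d x z = d x y + 1} = b (d x y)"
proof -
  have "{z. E y z \<and> P z} = {z \<in> V. E y z \<and> P z}" for y and P :: "'a \<Rightarrow> bool" using in_V by auto
  then show "\<lbrakk>x \<in> V; y \<in> V\<rbrakk> \<Longrightarrow> card {z. E y z \<and> d x z + 1 = d x y} = c (d x y)"
    and "\<lbrakk>x \<in> V; y \<in> V\<rbrakk> \<Longrightarrow> card {z. E y z \<and> d x z = d x y + 1} = b (d x y)"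
    using dr by (simp_all add: distance_regular_def)
qed

lemma card_nbrs:
  assumes "x \<in> V" shows "card {y. E x y} = b 0"
proof -
  have "{y. E x y} = {y. E x y \<and> d x y = d x x + 1}"
    using dist_1_iff[OF assms] in_V by auto
  then show ?thesis using card_up[OF assms assms] by simp
qed

lemma card_nbrs_split:
  assumes "x \<in> V" "y \<in> V"
  shows "b 0 = c (d x y) + card {z. E y z \<and> d x z = d x y} + b (d x y)"
proof -
  have "{z. E y z} = {z. E y z \<and> d x z + 1 = d x y} \<union> {z. E y z \<and> d x z = d x y}
      \<union> {z. E y z \<and> d x z = d x y + 1}"
    using dist_edge_cases[OF assms(1)] by auto
  moreover have "card \<dots> = c (d x y) + card {z. E y z \<and> d x z = d x y} + b (d x y)"
    using card_down[OF assms] card_up[OF assms] by (subst card_Un_disjoint; auto)+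
  ultimately show ?thesis using card_nbrs[OF assms(2)] by simp
qed

text \<open>The tridiagonal intersection matrix. At distances that occur,
  \<open>card_nbrs_split\<close> shows that the natural-number subtraction on the diagonal is not
  truncated.\<close>

definition nbr_count :: "nat \<Rightarrow> nat \<Rightarrow> nat" where
  "nbr_count j i = (if i = j + 1 then b j else if i + 1 = j then c j else if i = j then b 0 - b j - c j else 0)"

lemma card_nbrs_at_dist:
  assumes "x \<in> V" "y \<in> V"
  shows "card {z. E y z \<and> d x z = i} = nbr_count (d x y) i"
proof -
  consider "i = d x y + 1" | "i + 1 = d x y" | "i = d x y"
    | "i \<noteq> d x y + 1" "i + 1 \<noteq> d x y" "i \<noteq> d x y" by blast
  then show ?thesis
  proof cases
    case 1
    then show ?thesis using card_up[OF assms] by (simp add: nbr_count_def)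
  next
    case 2
    then have "{z. E y z \<and> d x z = i} = {z. E y z \<and> d x z + 1 = d x y}" by auto
    then show ?thesis using card_down[OF assms] 2 by (simp add: nbr_count_def)
  next
    case 3
    then show ?thesis using card_nbrs_split[OF assms] by (simp add: nbr_count_def)
  next
    case 4
    then have "{z. E y z \<and> d x z = i} = {}" using dist_edge_cases[OF assms(1), of y] by auto
    then show ?thesis using 4 by (simp only: nbr_count_def) simp
  qed
qed

lemma card_common_adj:
  assumes "E x y" shows "int (card {z. E x z \<and> E y z}) = inter_a b c 1"
proof -
  have xy: "x \<in> V" "y \<in> V" using assms in_V by auto
  then have d: "d x y = 1" using assms dist_1_iff by simp
  have "{z. E y z \<and> d x z = d x y} = {z. E x z \<and> E y z}"
    unfolding d using dist_1_iff[OF xy(1)] in_V by auto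
  then show ?thesis using card_nbrs_split[OF xy] by (simp add: d inter_a_def)
qed

text \<open>The vertices \<open>y\<close> and \<open>z\<close> are at distance 2 and have
  \<open>c 2\<close> common neighbours. One of them is \<open>x\<close>, which is not adjacent to
  itself.\<close>

lemma card_common_nonadj:
  assumes "E x y" "E x z" "y \<noteq> z" "\<not> E y z"
  shows "card {w. E x w \<and> E y w \<and> E z w} \<le> c 2 - 1"
proof -
  have V: "x \<in> V" "y \<in> V" "z \<in> V" using assms in_V by auto
  have "d y x = 1" using assms(1) sym dist_1_iff V by simp
  then have d: "d y z = 2"
    using dist_edge_cases[OF V(2) assms(2)] dist_0_iff[OF V(2,3)] dist_1_iff[OF V(2,3)] assms by auto
  let ?A = "{w. E z w \<and> d y w + 1 = d y z}"
  have "x \<in> ?A" using assms(2) sym d \<open>d y x = 1\<close> by auto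
  have "{w. E x w \<and> E y w \<and> E z w} \<subseteq> ?A - {x}" using d dist_1_iff[OF V(2)] in_V by auto
  then have "card {w. E x w \<and> E y w \<and> E z w} \<le> card (?A - {x})" by (intro card_mono) auto
  also have "\<dots> = c 2 - 1" using card_down[OF V(2,3)] d \<open>x \<in> ?A\<close> by simp
  finally show ?thesis .
qed

lemma diameter_ge_2:
  assumes "diameter V E \<ge> 2"
  shows "\<not> complete_graph V E" "c 2 \<ge> 1"
proof -
  let ?D = "{d x y | x y. x \<in> V \<and> y \<in> V}"
  have "?D = (\<lambda>(x, y). d x y) ` (V \<times> V)" by auto
  then have "finite ?D" using finite_V by simp
  moreover obtain v where "v \<in> V" using graph unfolding simple_graph_def by auto
  then have "?D \<noteq> {}" by blast
  ultimately have "diameter V E \<in> ?D" unfolding diameter_def by (rule Max_in)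
  then obtain x y where xy: "x \<in> V" "y \<in> V" "d x y \<ge> 2" using assms by auto
  then have "x \<noteq> y" "\<not> E x y" using dist_1_iff[OF xy(1,2)] by auto
  then show "\<not> complete_graph V E" using xy unfolding complete_graph_def by blast
  \<comment> \<open>Walking back from \<open>y\<close> along a shortest path reaches distance
    exactly 2; the next vertex on the way to \<open>x\<close> is then counted by
    \<open>c 2\<close>.\<close>
  have "\<exists>w\<in>V. d x w = 2"
    using xy
  proof (induction "d x y - 2" arbitrary: y)
    case 0
    then show ?case by (intro bexI[of _ y]) auto
  next
    case (Suc i)
    then have "d x y = Suc (i + 2)" by simp
    then obtain w where "w \<in> V" "d x w = i + 2" using dist_pred Suc.prems by metis
    then show ?case using Suc.hyps(1)[of w] Suc.prems by simp
  qed
  then obtain w where w: "w \<in> V" "d x w = 2" by blast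
  then obtain z where "z \<in> V" "E z w" "d x z = 1"
    using dist_pred[OF xy(1) w(1), of 1] by (auto simp: numeral_2_eq_2)
  then have "z \<in> {z. E w z \<and> d x z + 1 = d x w}" using w adj_commute by simp
  then have "card {z. E w z \<and> d x z + 1 = d x w} > 0" by (intro card_gt_0_iff[THEN iffD2]) auto
  then show "c 2 \<ge> 1" using card_down[OF xy(1) w(1)] w by simp
qed

section \<open>Radial eigenfunctions\<close>

text \<open>Neighbour counts between spheres do not depend on the centre, so a shortest path from
  \<open>x\<close> can be imitated from \<open>x'\<close>.\<close>

lemma sphere_nonempty:
  assumes "x \<in> V" "x' \<in> V" "y \<in> V"
  shows "\<exists>y'\<in>V. d x' y' = d x y"
  using assms(3)
proof (induction "d x y" arbitrary: y)
  case 0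
  then show ?case using assms by (intro bexI[of _ x']) auto
next
  case (Suc i)
  then obtain w where w: "w \<in> V" "E w y" "d x w = i" using dist_pred assms(1) by metis
  then obtain w' where w': "w' \<in> V" "d x' w' = i" using Suc by metis
  have "y \<in> {z. E w z \<and> d x z = Suc i}" using w Suc by auto
  then have "card {z. E w z \<and> d x z = Suc i} > 0" by (intro card_gt_0_iff[THEN iffD2]) auto
  then have "card {z. E w' z \<and> d x' z = Suc i} > 0"
    using card_nbrs_at_dist assms w w' by simp
  then obtain z where "E w' z" "d x' z = Suc i" by (auto simp: card_gt_0_iff)
  then show ?case using in_V Suc by auto
qed

text \<open>Averaging an eigenfunction over the spheres around a vertex where it does not vanish gives
  the standard sequence of the eigenvalue.\<close>

lemma radial_eigenfunction:
  assumes "adj_eigenvalue V E \<theta>"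
  shows "\<exists>u. u 0 \<noteq> 0 \<and> (\<forall>x\<in>V. \<forall>y\<in>V. (\<Sum>z | E y z. u (d x z)) = \<theta> * u (d x y))"
proof -
  obtain f x0 where x0: "x0 \<in> V" "f x0 \<noteq> 0"
    and f: "\<And>y. y \<in> V \<Longrightarrow> (\<Sum>z | E y z. f z) = \<theta> * f y"
    using assms unfolding adj_eigenvalue_def sum_nbrs by blast
  define J where "J = (\<lambda>(x, y). d x y) ` (V \<times> V)"
  have J_fin: "finite J" unfolding J_def using finite_V by simp
  have J: "d x y \<in> J" if "x \<in> V" "y \<in> V" for x y unfolding J_def using that by auto
  define S where "S = (\<lambda>i. {y \<in> V. d x0 y = i})"
  have S_fin [simp]: "finite (S i)" for i unfolding S_def using finite_V by simp
  define K where "K = (\<lambda>i. real (card (S i)))"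
  define \<sigma> where "\<sigma> = (\<lambda>i. \<Sum>y\<in>S i. f y)"
  define u where "u = (\<lambda>i. \<sigma> i / K i)"
  \<comment> \<open>\<open>K\<close> measures spheres around \<open>x0\<close>, but it has to be
    nonzero at distances realised anywhere in the graph.\<close>
  have K_pos: "K (d x y) > 0" if xy: "x \<in> V" "y \<in> V" for x y
    using sphere_nonempty[OF xy(1) x0(1) xy(2)] unfolding K_def S_def
    by (auto simp: card_gt_0_iff finite_V)
  have \<sigma>_u: "\<sigma> i = K i * u i" for i
    by (cases "S i = {}") (auto simp: u_def K_def \<sigma>_def)
  have cnt: "(\<Sum>y\<in>S i. if E z y then 1 else 0) = real (nbr_count j i)" if "z \<in> S j" for z i j
  proof -
    have "{y. E z y \<and> d x0 y = i} = {y \<in> S i. E z y}" unfolding S_def using in_V by auto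
    moreover have "card {y. E z y \<and> d x0 y = i} = nbr_count j i"
      using card_nbrs_at_dist[OF x0(1)] that unfolding S_def by auto
    ultimately show ?thesis
      by (subst sum.inter_filter[symmetric]) auto
  qed
  \<comment> \<open>Edges between two spheres around \<open>x0\<close> are counted from both
    ends.\<close>
  have K_p: "K i * real (nbr_count i j) = K j * real (nbr_count j i)" for i j
  proof -
    have "K i * real (nbr_count i j) = (\<Sum>y\<in>S i. \<Sum>z\<in>S j. if E y z then 1 else 0)"
      using cnt[of _ i j] by (simp add: K_def)
    also have "\<dots> = (\<Sum>z\<in>S j. \<Sum>y\<in>S i. if E z y then 1 else 0)"
      by (subst sum.swap) (simp add: adj_commute if_distrib cong: if_cong)
    also have "\<dots> = K j * real (nbr_count j i)" using cnt[of _ j i] by (simp add: K_def)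
    finally show ?thesis .
  qed
  \<comment> \<open>The eigenvalue equation is summed over one sphere and regrouped by spheres.
    Together with \<open>K_p\<close> this turns into the recurrence for \<open>u\<close>.\<close>
  have \<sigma>_p: "\<theta> * \<sigma> i = (\<Sum>j\<in>J. real (nbr_count j i) * \<sigma> j)" for i
  proof -
    have "\<theta> * \<sigma> i = (\<Sum>y\<in>S i. \<Sum>z | E y z. f z)"
      unfolding \<sigma>_def sum_distrib_left using f by (intro sum.cong) (auto simp: S_def)
    also have "\<dots> = (\<Sum>y\<in>S i. \<Sum>z\<in>V. if E y z then f z else 0)"
      by (simp only: sum_nbrs_if)
    also have "\<dots> = (\<Sum>z\<in>V. f z * (\<Sum>y\<in>S i. if E z y then 1 else 0))"
      unfolding sum_distrib_left by (subst sum.swap) (simp add: adj_commute if_distrib cong: if_cong)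
    also have "\<dots> = (\<Sum>j\<in>J. \<Sum>z\<in>{z \<in> V. d x0 z = j}. f z * (\<Sum>y\<in>S i. if E z y then 1 else 0))"
      using J[OF x0(1)] by (intro sum.group[symmetric] finite_V J_fin) auto
    also have "\<dots> = (\<Sum>j\<in>J. \<Sum>z\<in>S j. f z * real (nbr_count j i))"
      using cnt by (intro sum.cong) (auto simp: S_def)
    also have "\<dots> = (\<Sum>j\<in>J. real (nbr_count j i) * \<sigma> j)"
      by (simp only: \<sigma>_def mult.commute[of "real (nbr_count _ i)"] sum_distrib_right)
    finally show ?thesis .
  qed
  have "(\<Sum>z | E y z. u (d x z)) = \<theta> * u (d x y)" if xy: "x \<in> V" "y \<in> V" for x y
  proof -
    let ?i = "d x y"
    have "(\<Sum>z | E y z. u (d x z)) = (\<Sum>j\<in>J. \<Sum>z\<in>{z \<in> {z. E y z}. d x z = j}. u (d x z))"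
      using J[OF xy(1)] in_V by (intro sum.group[symmetric] J_fin) auto
    also have "\<dots> = (\<Sum>j\<in>J. \<Sum>z\<in>{z. E y z \<and> d x z = j}. u j)"
      by (intro sum.cong) auto
    also have "\<dots> = (\<Sum>j\<in>J. real (nbr_count ?i j) * u j)"
      by (simp add: card_nbrs_at_dist[OF xy])
    finally have "K ?i * (\<Sum>z | E y z. u (d x z)) = (\<Sum>j\<in>J. K ?i * real (nbr_count ?i j) * u j)"
      by (simp add: sum_distrib_left mult.assoc)
    also have "\<dots> = \<theta> * \<sigma> ?i"
      unfolding \<sigma>_p
    proof (rule sum.cong)
      show "K ?i * real (nbr_count ?i j) * u j = real (nbr_count j ?i) * \<sigma> j" for j
        using K_p[of ?i j] by (simp add: \<sigma>_u)
    qed simp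
    also have "\<dots> = K ?i * (\<theta> * u ?i)" by (simp add: \<sigma>_u)
    finally show ?thesis using K_pos[OF xy] by simp
  qed
  moreover have "S 0 = {x0}" unfolding S_def using dist_0_iff[OF x0(1)] x0(1) by auto
  then have "u 0 \<noteq> 0" using x0 by (simp add: u_def K_def \<sigma>_def)
  ultimately show ?thesis by blast
qed

section \<open>The valency bound and the exclusion of large claws\<close>

text \<open>\<open>A + m I\<close> is positive semidefinite, and one test vector supported on a
  closed neighbourhood gives the bound.\<close>

lemma valency_le:
  assumes ev: "smallest_eigenvalue V E \<theta>" "- real m \<le> \<theta>" and m: "m \<ge> 1"
    and l: "inter_a b c 1 = int l"
  shows "b 0 \<le> m * (l + m)"
proof -
  obtain x where x: "x \<in> V" using graph unfolding simple_graph_def by auto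
  define k where "k = real (b 0)"
  \<comment> \<open>Among vectors with value \<open>m\<close> on the neighbours of \<open>x\<close>
    and 0 farther out, the value \<open>- k\<close> at \<open>x\<close> minimises the form of
    \<open>A + m I\<close>.\<close>
  define f where "f = (\<lambda>y. if y = x then - k else if E x y then real m else 0)"
  have fx: "f x = - k" by (simp add: f_def)
  have fy: "f y = real m" if "E x y" for y using that by (auto simp: f_def)
  have supp: "(\<Sum>y\<in>V. f y * g y) = - k * g x + (\<Sum>y | E x y. real m * g y)" for g
  proof -
    have "(\<Sum>y\<in>V. f y * g y) = (\<Sum>y\<in>insert x {y. E x y}. f y * g y)"
      using x in_V finite_V by (intro sum.mono_neutral_right) (auto simp: f_def)
    then show ?thesis by (simp add: fx fy)
  qed
  have "(\<Sum>z | E y z. f z) = - k + real m * real l" if y: "E x y" for y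
  proof -
    have "(\<Sum>z | E y z. f z) = (\<Sum>z\<in>insert x {z. E x z \<and> E y z}. f z)"
      using sym[OF y] by (intro sum.mono_neutral_right) (auto simp: f_def)
    moreover have "card {z. E x z \<and> E y z} = l" using card_common_adj[OF y] l by simp
    ultimately show ?thesis by (simp add: fx fy)
  qed
  then have F: "(\<Sum>y\<in>V. f y * (\<Sum>z | E y z. f z)) = - k * (real m * k) + k * (real m * (- k + real m * real l))"
    unfolding supp using card_nbrs[OF x] by (simp add: fy k_def)
  have N: "(\<Sum>y\<in>V. (f y)\<^sup>2) = k * k + k * (real m * real m)"
    unfolding power2_eq_square supp using card_nbrs[OF x] by (simp add: fx fy k_def)
  have "- real m * (\<Sum>y\<in>V. (f y)\<^sup>2) \<le> \<theta> * (\<Sum>y\<in>V. (f y)\<^sup>2)"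
    using ev(2) by (intro mult_right_mono sum_nonneg) auto
  from order_trans[OF this adjacency_form_ge[OF ev(1)]] have "- real m * (k * k + k * (real m * real m))
      \<le> - k * (real m * k) + k * (real m * (- k + real m * real l))"
    unfolding F N .
  then have "(real m * k) * k \<le> (real m * k) * (real m * (real l + real m))"
    by (simp add: algebra_simps)
  then have "k \<le> real m * (real l + real m)" if "k > 0"
    using that m by (subst (asm) mult_le_cancel_left_pos) auto
  then have "k \<le> real (m * (l + m))" by (cases "k > 0") (auto simp: k_def)
  then show ?thesis unfolding k_def by (simp only: of_nat_le_iff)
qed

text \<open>In the local graph at \<open>x\<close>, the closed neighbourhoods of
  \<open>m + 1\<close> independent vertices have size \<open>l + 1\<close> and pairwise overlaps of
  at most \<open>n\<close>. Their union would exceed the valency bound.\<close>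

lemma claw_le:
  assumes ev: "smallest_eigenvalue V E \<theta>" "- real m \<le> \<theta>" and m: "m \<ge> 1"
    and l: "inter_a b c 1 = int l" and l_large: "m\<^sup>2 * (n + 1) < l"
    and quad: "\<And>x y z. \<lbrakk>E x y; E x z; y \<noteq> z; \<not> E y z\<rbrakk> \<Longrightarrow> card {w. E x w \<and> E y w \<and> E z w} \<le> n"
    and S: "S \<subseteq> {y. E x y}" and ind: "\<And>y z. \<lbrakk>y \<in> S; z \<in> S\<rbrakk> \<Longrightarrow> \<not> E y z"
  shows "card S \<le> m"
proof (rule ccontr)
  assume "\<not> card S \<le> m"
  then obtain S' where S': "S' \<subseteq> S" "card S' = m + 1" "finite S'"
    using obtain_subset_with_card_n[of "m + 1" S] by auto
  have adj: "E x y" if "y \<in> S'" for y using that S' S by auto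
  define A where "A = (\<lambda>y. insert y {z. E x z \<and> E y z})"
  have "card (A y) = l + 1" if "y \<in> S'" for y
    unfolding A_def using card_common_adj[OF adj[OF that]] l by simp
  moreover have "card (A y \<inter> A z) \<le> n" if yz: "y \<in> S'" "z \<in> S'" "y \<noteq> z" for y z
  proof -
    have "\<not> E y z" "\<not> E z y" using yz S' ind by auto
    then have "A y \<inter> A z = {w. E x w \<and> E y w \<and> E z w}" unfolding A_def using yz by auto
    then show ?thesis using quad[OF adj adj] yz \<open>\<not> E y z\<close> by simp
  qed
  ultimately have "2 * card S' * (l + 1)
      \<le> 2 * card (\<Union>y\<in>S'. A y) + card S' * (card S' - 1) * n"
    using S'(3) by (intro bonferroni_uniform) (auto simp: A_def)
  moreover have "S' \<noteq> {}" using S' by auto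
  then have "x \<in> V" using adj in_V by blast
  have "card (\<Union>y\<in>S'. A y) \<le> card {y. E x y}"
    using adj by (intro card_mono) (auto simp: A_def)
  then have "card (\<Union>y\<in>S'. A y) \<le> m * (l + m)"
    using card_nbrs[OF \<open>x \<in> V\<close>] valency_le[OF ev m l] by simp
  ultimately have claw: "2 * (m + 1) * (l + 1) \<le> 2 * (m * (l + m)) + (m + 1) * m * n"
    unfolding S'(2) by simp
  \<comment> \<open>The products become atoms: \<open>W\<close> is \<open>m * l\<close>,
    \<open>Y\<close> is \<open>m\<^sup>2 * n\<close> and \<open>Z\<close> is
    \<open>m\<^sup>2\<close>.\<close>
  have linear: "\<lbrakk>A \<le> 2 * B + X; Y + Z < l; X \<le> 2 * Y; A = 2 * W + 2 * l + 2 * m + 2; B = W + Z\<rbrakk>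
      \<Longrightarrow> False" for A B W X Y Z :: nat
    by linarith
  show False
  proof (rule linear[OF claw])
    show "m\<^sup>2 * n + m\<^sup>2 < l" using l_large by (simp add: algebra_simps)
    show "(m + 1) * m * n \<le> 2 * (m\<^sup>2 * n)"
      using m by (simp add: power2_eq_square algebra_simps)
    show "2 * (m + 1) * (l + 1) = 2 * (m * l) + 2 * l + 2 * m + 2" by simp
    show "m * (l + m) = m * l + m\<^sup>2" by (simp add: power2_eq_square algebra_simps)
  qed
qed

end

section \<open>The smallest eigenvalue and the size of lines\<close>

theorem theorem5p3:
  fixes V :: "'a set" and E :: "'a \<Rightarrow> 'a \<Rightarrow> bool"
    and b c :: "nat \<Rightarrow> nat" and m :: nat and \<theta> :: real
  assumes "m \<ge> 2"
    and "distance_regular V E b c"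
    and "diameter V E \<ge> 2"
    and "smallest_eigenvalue V E \<theta>"
    and "- real m \<le> \<theta>" and "\<theta> < 1 - real m"
    and "inter_a b c 1 > int (m ^ 2) * int (c 2)"
  shows "geometric V E (b 0) \<theta> \<and> \<theta> = - real m"
proof -
  interpret distance_regular_graph V E b c
    by unfold_locales (rule assms(2))
  have m: "m \<ge> 1" using assms(1) by simp
  note diam = diameter_ge_2[OF assms(3)]
  define n where "n = c 2 - 1"
  have n: "n + 1 = c 2" unfolding n_def using diam(2) by simp
  define l where "l = nat (inter_a b c 1)"
  have "inter_a b c 1 > 0" using assms(7) by (meson le_less_trans mult_nonneg_nonneg of_nat_0_le_iff)
  then have l: "inter_a b c 1 = int l" unfolding l_def by simp
  have l_large: "m\<^sup>2 * (n + 1) < l"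
    using assms(7) unfolding l n by (simp only: of_nat_mult[symmetric] of_nat_less_iff)
  interpret line_graph_conditions V E l n m
  proof unfold_locales
    show common: "card {z. E x z \<and> E y z} = l" if "E x y" for x y
      using card_common_adj[OF that] l by simp
    show quad: "card {w. E x w \<and> E y w \<and> E z w} \<le> n" if "E x y" "E x z" "y \<noteq> z" "\<not> E y z" for x y z
      unfolding n_def by (rule card_common_nonadj[OF that])
    show "m\<^sup>2 * (n + 1) < l" by (rule l_large)
    show "card S \<le> m" if "S \<subseteq> {y. E x y}" "\<And>y z. \<lbrakk>y \<in> S; z \<in> S\<rbrakk> \<Longrightarrow> \<not> E y z" for S x
      by (rule claw_le[OF assms(4,5) m l l_large quad that])
  qed
  let ?L = "{C. line C}"
  have r_le: "card (lines_at x) \<le> m" if "x \<in> V" for x using card_lines_at_le[OF that m] .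
  \<comment> \<open>If every vertex were on at most \<open>m - 1\<close> lines,
    \<open>A = N N\<^sup>T - R\<close> would have no eigenvalue below \<open>1 - m\<close>, contrary
    to the bound on \<open>\<theta>\<close>.\<close>
  have "\<exists>x\<in>V. card (lines_at x) = m"
  proof (rule ccontr)
    assume "\<not> ?thesis"
    then have r: "real (card (lines_at x)) \<le> real m - 1" if "x \<in> V" for x
      using r_le[OF that] that by (metis Suc_leI add.commute le_diff_eq le_neq_implies_less of_nat_Suc of_nat_le_iff)
    obtain f where f: "\<exists>x\<in>V. f x \<noteq> 0" "\<forall>x\<in>V. (\<Sum>y | E x y. f y) = \<theta> * f x"
      using assms(4) unfolding smallest_eigenvalue_def adj_eigenvalue_def sum_nbrs by blast
    have pos: "(\<Sum>x\<in>V. (f x)\<^sup>2) > 0" using f(1) finite_V by (auto intro!: sum_pos2)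
    have "(\<Sum>x\<in>V. f x * (\<Sum>y | E x y. f y)) = (\<Sum>x\<in>V. \<theta> * (f x)\<^sup>2)"
      using f(2) by (intro sum.cong) (auto simp: power2_eq_square)
    then have "\<theta> * (\<Sum>x\<in>V. (f x)\<^sup>2) = (\<Sum>x\<in>V. f x * (\<Sum>y | E x y. f y))"
      by (simp add: sum_distrib_left)
    moreover have "(\<Sum>x\<in>V. f x * (\<Sum>y | E x y. f y)) \<ge> - (\<Sum>x\<in>V. real (card (lines_at x)) * (f x)\<^sup>2)"
      unfolding adjacency_form_lines[OF m] by (simp add: sum_nonneg)
    moreover have "(\<Sum>x\<in>V. real (card (lines_at x)) * (f x)\<^sup>2) \<le> (real m - 1) * (\<Sum>x\<in>V. (f x)\<^sup>2)"
      unfolding sum_distrib_left using r by (intro sum_mono mult_right_mono) auto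
    ultimately have "(1 - real m) * (\<Sum>x\<in>V. (f x)\<^sup>2) \<le> \<theta> * (\<Sum>x\<in>V. (f x)\<^sup>2)"
      by (simp add: algebra_simps)
    then show False using pos assms(6) by (simp add: mult_le_cancel_right)
  qed
  then obtain x0 where x0: "x0 \<in> V" "card (lines_at x0) = m" by blast
  have r: "card (lines_at x) = m" if "x \<in> V" for x
    using card_lines_at_const[OF card_nbrs[OF x0(1)] card_nbrs[OF that] m] x0 r_le[OF that] by simp
  \<comment> \<open>A nonzero vector in the kernel of \<open>N\<^sup>T\<close>; as every vertex is
    on \<open>m\<close> lines, it is an eigenvector of \<open>A\<close> for
    \<open>- m\<close>.\<close>
  obtain f where f: "\<exists>x\<in>V. f x \<noteq> 0" "\<forall>C\<in>?L. (\<Sum>v\<in>V. (if v \<in> C then 1 else 0) * f v) = (0::real)"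
    using underdetermined_system[OF finite_lines finite_V card_lines_less[OF r], of "\<lambda>C v. if v \<in> C then 1 else 0"]
    by blast
  have "(\<Sum>v\<in>V. (if v \<in> C then 1 else 0) * f v) = (\<Sum>v\<in>C. f v)" if "line C" for C
  proof -
    have "(\<Sum>v\<in>V. (if v \<in> C then 1 else 0) * f v) = (\<Sum>v\<in>V. if v \<in> C then f v else 0)"
      by (rule sum.cong) auto
    then show ?thesis
      using points_of_line[OF that] by (simp add: sum.inter_filter[OF finite_V, symmetric])
  qed
  then have "\<forall>x\<in>V. (\<Sum>y\<in>{y \<in> V. E x y}. f y) = - real m * f x"
    unfolding sum_nbrs sum_over_lines[OF m] using f(2) r by simp
  then have "adj_eigenvalue V E (- real m)" unfolding adj_eigenvalue_def using f(1) by blast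
  then have "\<theta> \<le> - real m" using assms(4) unfolding smallest_eigenvalue_def by blast
  then have \<theta>: "\<theta> = - real m" using assms(5) by simp
  obtain u where u0: "u 0 \<noteq> 0"
    and u: "\<And>x y. \<lbrakk>x \<in> V; y \<in> V\<rbrakk> \<Longrightarrow> (\<Sum>z | E y z. u (d x z)) = \<theta> * u (d x y)"
    using radial_eigenfunction assms(4) unfolding smallest_eigenvalue_def by blast
  have delsarte: "delsarte_clique V E (b 0) \<theta> C" if C: "line C" for C
  proof -
    have clique: "is_clique V E C" using C unfolding line_def by simp
    obtain x where x: "x \<in> C" using line_card_gt[OF C] by fastforce
    then have xV: "x \<in> V" using clique unfolding is_clique_def by auto
    define g where "g = (\<lambda>y. u (d x y))"
    \<comment> \<open>For an eigenvector of \<open>- m\<close>, the form of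
      \<open>A + m I = N N\<^sup>T\<close> vanishes, so all line sums vanish.\<close>
    have "(\<Sum>C | line C. (\<Sum>y\<in>C. g y)\<^sup>2) = 0"
    proof -
      have "(\<Sum>y\<in>V. g y * (\<Sum>z | E y z. g z)) = (\<Sum>y\<in>V. - (real m * (g y)\<^sup>2))"
        using u[OF xV] \<theta> by (intro sum.cong) (auto simp: g_def power2_eq_square)
      moreover have "(\<Sum>x\<in>V. real (card (lines_at x)) * (g x)\<^sup>2) = (\<Sum>x\<in>V. real m * (g x)\<^sup>2)"
        using r by (intro sum.cong) auto
      ultimately show ?thesis using adjacency_form_lines[OF m, of g] by (simp add: sum_negf)
    qed
    then have "(\<Sum>y\<in>C. g y) = 0"
      using C finite_lines by (simp add: sum_nonneg_eq_0_iff)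
    moreover have "g y = u 1" if "y \<in> C - {x}" for y
      using that dist_adj[OF line_adj[OF C x, of y]] by (auto simp: g_def)
    then have "(\<Sum>y\<in>C - {x}. g y) = real (card (C - {x})) * u 1" by simp
    moreover have "(\<Sum>y\<in>C. g y) = g x + (\<Sum>y\<in>C - {x}. g y)"
      using x line_finite[OF C] by (rule sum.remove[rotated])
    moreover have "g x = u 0" by (simp add: g_def)
    ultimately have 1: "u 0 + real (card (C - {x})) * u 1 = 0" by simp
    have "(\<Sum>z | E x z. u (d x z)) = (\<Sum>z | E x z. u 1)"
      using dist_adj by (intro sum.cong) auto
    then have 2: "real (b 0) * u 1 = - real m * u 0"
      using u[OF xV xV] card_nbrs[OF xV] \<theta> by simp
    \<comment> \<open>The line sum relates \<open>u 0\<close> to \<open>u 1\<close> through the size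
      of \<open>C\<close>, and the eigenvalue equation at \<open>x\<close> relates them through
      \<open>k = b 0\<close>. Eliminating \<open>u 1\<close> and cancelling the nonzero
      \<open>u 0\<close> leaves \<open>k\<close> equal to \<open>m\<close> times
      \<open>card C - 1\<close>.\<close>
    have "real (b 0) * u 0 + real (card (C - {x})) * (real (b 0) * u 1) = 0"
      using arg_cong[OF 1, of "\<lambda>t. real (b 0) * t"] by (simp add: algebra_simps)
    then have "u 0 * (real (b 0) - real (card (C - {x})) * real m) = 0"
      unfolding 2 by (simp add: algebra_simps)
    then have "real (b 0) = real (card (C - {x})) * real m" using u0 by simp
    then have "real (card (C - {x})) = real (b 0) / real m" using m by simp
    moreover have "card C = Suc (card (C - {x}))" using card_Suc_Diff1[OF line_finite[OF C] x] by simp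
    ultimately show ?thesis unfolding delsarte_clique_def \<theta> using clique by simp
  qed
  have "\<exists>!C. C \<in> ?L \<and> x \<in> C \<and> y \<in> C" if "E x y" for x y
    using edge_in_line[OF that] two_lines_through_edge[OF _ _ that _ _ _ _ m] by blast
  then have "geometric V E (b 0) \<theta>"
    unfolding geometric_def using diam(1) delsarte by (intro conjI exI[of _ ?L]) auto
  then show ?thesis using \<theta> by simp
qed

end
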